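(* Every finite connected bipartite $3$-NU graph has, for each of its edges $e$, an efficient dismantling to $e$. Every finite connected $3$-NU graph has, for each of its looped vertices $v$, an efficient dismantling to $v$.
   Context: Graphs are undirected, may have loops, and have no multiple edges. A bipartite graph has no loops. A homomorphism is an edge-preserving vertex map. $H^3$ is the categorical product: triples are adjacent iff they are adjacent in every coordinate. $H$ is a $3$-NU graph if there is a homomorphism $f:H^3\to H$ with $f(x_1,x_2,x_3)=x$ whenever at least two of the $x_i$ are equal to $x$. A vertex $v'\neq v$ dominates $v$ in a graph $K$ if $N(v)\subseteq N(v')$ (where $v\in N(v)$ iff $v$ has a loop). Then the map $K\to K\setminus\{v\}$ sending $v$ to $v'$ and fixing all other vertices is a dismantling retraction; it dismantles $v$ (to $v'$). A dismantling of $H$ to a subgraph $R$ is a (possibly empty) sequence of dismantling retractions $d_1,\dots,d_\ell$, each $d_{i+1}$ applied to the image of $d_i\circ\cdots\circ d_1$, whose composition is a retraction of $H$ onto $R$. The dismantling is efficient if at every step the dismantled vertex $v$ is sent to a vertex $v'$ strictly closer to $R$ than $v$ is (distance to $R$ being the minimum distance to a vertex of $R$). An edge is regarded as the subgraph consisting of its two endpoints and the edge; a looped vertex as the subgraph consisting of the vertex with its loop. *)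

theory Defs
  imports Main "HOL-Library.Extended_Nat" "HOL-Library.FuncSet"
begin

record 'a ugraph =
  verts :: "'a set"
  edges :: "('a \<times> 'a) set"

definition ugraph :: "'a ugraph \<Rightarrow> bool" where
  "ugraph G \<longleftrightarrow> edges G \<subseteq> verts G \<times> verts G \<and> sym (edges G)"

definition finite_graph :: "'a ugraph \<Rightarrow> bool" where
  "finite_graph G \<longleftrightarrow> finite (verts G)"

definition connected_graph :: "'a ugraph \<Rightarrow> bool" where
  "connected_graph G \<longleftrightarrow> (\<forall>u\<in>verts G. \<forall>v\<in>verts G. (u, v) \<in> (edges G)\<^sup>*)"

definition bipartite_graph :: "'a ugraph \<Rightarrow> bool" where
  "bipartite_graph G \<longleftrightarrow>
     (\<exists>A B. A \<union> B = verts G \<and> A \<inter> B = {} \<and> edges G \<subseteq> A \<times> B \<union> B \<times> A)"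

definition nbhd :: "'a ugraph \<Rightarrow> 'a \<Rightarrow> 'a set" where
  "nbhd G v = {w. (v, w) \<in> edges G}"

definition is_subgraph :: "'a ugraph \<Rightarrow> 'a ugraph \<Rightarrow> bool" where
  "is_subgraph R G \<longleftrightarrow> ugraph R \<and> verts R \<subseteq> verts G \<and> edges R \<subseteq> edges G"

definition graph_hom :: "'a ugraph \<Rightarrow> 'b ugraph \<Rightarrow> ('a \<Rightarrow> 'b) \<Rightarrow> bool" where
  "graph_hom G H f \<longleftrightarrow>
     f \<in> verts G \<rightarrow> verts H \<and> (\<forall>(u, v)\<in>edges G. (f u, f v) \<in> edges H)"

definition graph_cube :: "'a ugraph \<Rightarrow> ('a \<times> 'a \<times> 'a) ugraph" where
  "graph_cube H =
     \<lparr>verts = verts H \<times> verts H \<times> verts H,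
      edges = {((x1, x2, x3), (y1, y2, y3)) | x1 x2 x3 y1 y2 y3.
                 (x1, y1) \<in> edges H \<and> (x2, y2) \<in> edges H \<and> (x3, y3) \<in> edges H}\<rparr>"

definition NU3_graph :: "'a ugraph \<Rightarrow> bool" where
  "NU3_graph H \<longleftrightarrow>
     (\<exists>f. graph_hom (graph_cube H) H f \<and>
          (\<forall>x\<in>verts H. \<forall>y\<in>verts H.
             f (x, x, y) = x \<and> f (x, y, x) = x \<and> f (y, x, x) = x))"

definition graph_retraction :: "'a ugraph \<Rightarrow> 'a ugraph \<Rightarrow> ('a \<Rightarrow> 'a) \<Rightarrow> bool" where
  "graph_retraction H R f \<longleftrightarrow>
     is_subgraph R H \<and> graph_hom H R f \<and> (\<forall>x\<in>verts R. f x = x)"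

definition dominates :: "'a ugraph \<Rightarrow> 'a \<Rightarrow> 'a \<Rightarrow> bool" where
  "dominates K v' v \<longleftrightarrow>
     v \<in> verts K \<and> v' \<in> verts K \<and> v' \<noteq> v \<and> nbhd K v \<subseteq> nbhd K v'"

definition del_vertex :: "'a ugraph \<Rightarrow> 'a \<Rightarrow> 'a ugraph" where
  "del_vertex K v =
     \<lparr>verts = verts K - {v}, edges = {(x, y) \<in> edges K. x \<noteq> v \<and> y \<noteq> v}\<rparr>"

definition dismantle_map :: "'a \<Rightarrow> 'a \<Rightarrow> 'a \<Rightarrow> 'a" where
  "dismantle_map v v' = id(v := v')"

text \<open>
  A sequence of dismantling retractions is encoded by the list of pairs \<open>(v, v')\<close>, in order of
  application, where \<open>v\<close> is dismantled to \<open>v'\<close>. The image of the graph \<open>K\<close> under such a step is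
  \<open>del_vertex K v\<close>.
\<close>

fun dismantling_seq :: "'a ugraph \<Rightarrow> ('a \<times> 'a) list \<Rightarrow> bool" where
  "dismantling_seq K [] \<longleftrightarrow> True"
| "dismantling_seq K ((v, v') # ds) \<longleftrightarrow> dominates K v' v \<and> dismantling_seq (del_vertex K v) ds"

fun dismantling_comp :: "('a \<times> 'a) list \<Rightarrow> 'a \<Rightarrow> 'a" where
  "dismantling_comp [] = id"
| "dismantling_comp ((v, v') # ds) = dismantling_comp ds \<circ> dismantle_map v v'"

definition dismantling :: "'a ugraph \<Rightarrow> 'a ugraph \<Rightarrow> ('a \<times> 'a) list \<Rightarrow> bool" where
  "dismantling H R ds \<longleftrightarrow>
     dismantling_seq H ds \<and> graph_retraction H R (dismantling_comp ds)"

text \<open>The infimum of the empty set is \<open>\<infinity>\<close>, the distance between different components.\<close>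

definition graph_dist :: "'a ugraph \<Rightarrow> 'a \<Rightarrow> 'a \<Rightarrow> enat" where
  "graph_dist G u v = (INF n\<in>{n. (u, v) \<in> edges G ^^ n}. enat n)"

definition dist_to_subgraph :: "'a ugraph \<Rightarrow> 'a ugraph \<Rightarrow> 'a \<Rightarrow> enat" where
  "dist_to_subgraph G R v = (INF r\<in>verts R. graph_dist G v r)"

text \<open>
  Distances are measured in \<open>H\<close>. Every intermediate graph is a retract of \<open>H\<close>, hence an isometric
  subgraph, so measuring them in the current graph would give the same notion.
\<close>

definition efficient_dismantling :: "'a ugraph \<Rightarrow> 'a ugraph \<Rightarrow> ('a \<times> 'a) list \<Rightarrow> bool" where
  "efficient_dismantling H R ds \<longleftrightarrow>
     dismantling H R ds \<and>
     (\<forall>(v, v')\<in>set ds. dist_to_subgraph H R v' < dist_to_subgraph H R v)"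

text \<open>For \<open>u = v\<close> this is the looped vertex \<open>v\<close> together with its loop.\<close>

definition edge_subgraph :: "'a \<Rightarrow> 'a \<Rightarrow> 'a ugraph" where
  "edge_subgraph u v = \<lparr>verts = {u, v}, edges = {(u, v), (v, u)}\<rparr>"

end

theory Submission
  imports Defs
begin

text \<open>
  Let \<open>f\<close> be a \<open>3\<close>-NU homomorphism, and call a vertex set absorbing if \<open>f\<close> takes a value in it as
  soon as two of the three arguments lie in it. Singletons are absorbing, and so is the set of all
  neighbours of an absorbing set; hence for each \<open>n\<close> the vertices with a walk of length exactly
  \<open>n\<close> to a given vertex form an absorbing set. Pairwise intersecting absorbing sets have a
  common point (the Helly property). If \<open>x\<close> is at maximal distance \<open>m + 1\<close> from \<open>e\<close>, then every
  neighbour \<open>w\<close> of \<open>x\<close> has a walk of length exactly \<open>m + 1\<close> to one and the same end \<open>a\<close> of \<open>e\<close>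
  (walks can be lengthened by going back and forth along \<open>e\<close>, and the end is determined by
  parity). So the neighbourhoods of the \<open>w\<close> and the set of vertices with a walk of length \<open>m\<close> to
  \<open>a\<close> intersect pairwise, and a common point dominates \<open>x\<close> and is closer to \<open>e\<close>. Deleting \<open>x\<close>
  leaves a retract, which inherits all hypotheses and all distances.
\<close>

section \<open>Absorbing sets and the Helly property\<close>

definition absorbing :: "'a set \<Rightarrow> ('a \<times> 'a \<times> 'a \<Rightarrow> 'a) \<Rightarrow> 'a set \<Rightarrow> bool" where
  "absorbing V f S \<longleftrightarrow>
     S \<subseteq> V \<and> (\<forall>x\<in>S. \<forall>y\<in>S. \<forall>z\<in>V. f (x, y, z) \<in> S \<and> f (x, z, y) \<in> S \<and> f (z, x, y) \<in> S)"

lemma absorbing_Int: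
  "absorbing V f A \<Longrightarrow> absorbing V f B \<Longrightarrow> absorbing V f (A \<inter> B)"
  unfolding absorbing_def by blast

text \<open>Apply \<open>f\<close> to one point from each pairwise intersection: each of the three
  sets contains two of the three arguments, so the value lies in all of them.\<close>

lemma absorbing_triple_Int_nonempty:
  assumes A: "absorbing V f A" and B: "absorbing V f B" and C: "absorbing V f C"
    and "A \<inter> B \<noteq> {}" and "A \<inter> C \<noteq> {}" and "B \<inter> C \<noteq> {}"
  shows "A \<inter> B \<inter> C \<noteq> {}"
proof -
  obtain x y z where x: "x \<in> A" "x \<in> B" and y: "y \<in> A" "y \<in> C" and z: "z \<in> B" "z \<in> C"
    using assms(4-6) by blast
  have V: "x \<in> V" "y \<in> V" "z \<in> V"
    using A B x y z by (auto simp: absorbing_def)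
  have "f (x, y, z) \<in> A" using A x y V by (simp add: absorbing_def)
  moreover have "f (x, y, z) \<in> B" using B x z V by (simp add: absorbing_def)
  moreover have "f (x, y, z) \<in> C" using C y z V by (simp add: absorbing_def)
  ultimately show ?thesis by blast
qed

text \<open>Induction on \<open>F\<close> with \<open>A\<close> as accumulator: \<open>A\<close> is
  replaced by \<open>A \<inter> B\<close>, and the case of three sets shows that this still meets
  every remaining set.\<close>

lemma absorbing_Helly:
  assumes "finite F" and "absorbing V f A" and "\<forall>B\<in>F. absorbing V f B"
    and "A \<noteq> {}" and "\<forall>B\<in>F. A \<inter> B \<noteq> {}" and "\<forall>B\<in>F. \<forall>C\<in>F. B \<inter> C \<noteq> {}"
  shows "A \<inter> \<Inter>F \<noteq> {}"
  using assms
proof (induction F arbitrary: A rule: finite_induct)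
  case empty
  then show ?case by simp
next
  case (insert B F)
  have "A \<inter> B \<inter> C \<noteq> {}" if "C \<in> F" for C
    by (rule absorbing_triple_Int_nonempty[of V f]) (use insert.prems that in simp_all)
  then have "A \<inter> B \<inter> \<Inter>F \<noteq> {}"
    using insert.prems by (intro insert.IH) (simp_all add: absorbing_Int)
  then show ?case by (simp add: Int_assoc)
qed

text \<open>Edges from \<open>x\<close> and \<open>y\<close> to \<open>s\<close> and
  \<open>s'\<close> in \<open>S\<close>, and any edge from \<open>z\<close> to some
  \<open>t\<close>, are combined by \<open>f\<close> into an edge from \<open>f (x, y, z)\<close> to
  \<open>f (s, s', t)\<close>, which lies in \<open>S\<close>. The neighbour \<open>t\<close> of the
  arbitrary argument exists because no vertex is isolated.\<close>

lemma absorbing_nbhd_Image: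
  assumes G: "ugraph G" and f: "graph_hom (graph_cube G) G f" and S: "absorbing (verts G) f S"
    and nonisolated: "\<And>z. z \<in> verts G \<Longrightarrow> \<exists>t. (z, t) \<in> edges G"
  shows "absorbing (verts G) f {y. \<exists>s\<in>S. (y, s) \<in> edges G}"
proof -
  have step: "(f (a, b, c), f (a', b', c')) \<in> edges G"
    if "(a, a') \<in> edges G" "(b, b') \<in> edges G" "(c, c') \<in> edges G" for a b c a' b' c'
    using f that by (force simp: graph_hom_def graph_cube_def)
  have V: "t \<in> verts G" "z \<in> verts G" if "(z, t) \<in> edges G" for z t
    using G that by (auto simp: ugraph_def)
  show ?thesis
    unfolding absorbing_def
  proof (intro conjI ballI)
    show "{y. \<exists>s\<in>S. (y, s) \<in> edges G} \<subseteq> verts G"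
      using V by blast
  next
    fix x y z
    assume "x \<in> {y. \<exists>s\<in>S. (y, s) \<in> edges G}" "y \<in> {y. \<exists>s\<in>S. (y, s) \<in> edges G}" "z \<in> verts G"
    then obtain s s' t where e: "s \<in> S" "s' \<in> S" "(x, s) \<in> edges G" "(y, s') \<in> edges G"
        "(z, t) \<in> edges G"
      using nonisolated by blast
    then have "f (s, s', t) \<in> S" "f (s, t, s') \<in> S" "f (t, s, s') \<in> S"
      using S V unfolding absorbing_def by blast+
    then show "f (x, y, z) \<in> {y. \<exists>s\<in>S. (y, s) \<in> edges G}"
      "f (x, z, y) \<in> {y. \<exists>s\<in>S. (y, s) \<in> edges G}"
      "f (z, x, y) \<in> {y. \<exists>s\<in>S. (y, s) \<in> edges G}"
      using step e by blast+
  qed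
qed

lemma absorbing_walks:
  assumes "ugraph G" and f: "graph_hom (graph_cube G) G f"
    and nu: "\<forall>x\<in>verts G. \<forall>y\<in>verts G. f (x, x, y) = x \<and> f (x, y, x) = x \<and> f (y, x, x) = x"
    and "\<And>z. z \<in> verts G \<Longrightarrow> \<exists>t. (z, t) \<in> edges G" and "a \<in> verts G"
  shows "absorbing (verts G) f {y. (y, a) \<in> edges G ^^ n}"
proof (induction n)
  case 0
  show ?case using nu \<open>a \<in> verts G\<close> by (auto simp: absorbing_def)
next
  case (Suc n)
  have "{y. (y, a) \<in> edges G ^^ Suc n}
      = {y. \<exists>s\<in>{y. (y, a) \<in> edges G ^^ n}. (y, s) \<in> edges G}"
    by (auto simp del: relpow.simps intro: relpow_Suc_I2 elim!: relpow_Suc_E2)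
  then show ?case
    using absorbing_nbhd_Image[OF assms(1) f Suc assms(4)] by simp
qed

section \<open>Walks and distances to an edge\<close>

lemma dist_to_edge_le:
  assumes "(x, a) \<in> edges G ^^ n" and "a \<in> {u, v}"
  shows "dist_to_subgraph G (edge_subgraph u v) x \<le> enat n"
proof -
  have "dist_to_subgraph G (edge_subgraph u v) x \<le> graph_dist G x a"
    using assms(2) unfolding dist_to_subgraph_def
    by (intro INF_lower) (auto simp: edge_subgraph_def)
  also have "\<dots> \<le> enat n"
    unfolding graph_dist_def using assms(1) by (intro INF_lower) simp
  finally show ?thesis .
qed

lemma dist_to_edge_le_imp_walk:
  assumes "dist_to_subgraph G (edge_subgraph u v) x \<le> enat n"
  obtains a k where "a \<in> {u, v}" "k \<le> n" "(x, a) \<in> edges G ^^ k"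
proof -
  \<comment> \<open>A strict bound is what lets \<open>INF_less_iff\<close> extract a witness from
    each of the two nested infima.\<close>
  have "dist_to_subgraph G (edge_subgraph u v) x < enat (Suc n)"
    using assms by (rule le_less_trans) simp
  then have "\<exists>a\<in>verts (edge_subgraph u v). graph_dist G x a < enat (Suc n)"
    unfolding dist_to_subgraph_def INF_less_iff .
  then obtain a where a: "a \<in> {u, v}" and "graph_dist G x a < enat (Suc n)"
    by (auto simp: edge_subgraph_def)
  then obtain k where "(x, a) \<in> edges G ^^ k" "k \<le> n"
    unfolding graph_dist_def INF_less_iff by auto
  then show ?thesis using that[OF a] by blast
qed

lemma walk_to_edge_extend:
  assumes "ugraph G" and uv: "(u, v) \<in> edges G"
    and walk: "(x, b) \<in> edges G ^^ k" "b \<in> {u, v}" and "k \<le> n"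
  shows "\<exists>a\<in>{u, v}. (x, a) \<in> edges G ^^ n"
  using \<open>k \<le> n\<close>
proof (induction n rule: dec_induct)
  case base
  then show ?case using walk by blast
next
  case (step n)
  have "(v, u) \<in> edges G" using assms(1) uv by (auto simp: ugraph_def dest: symD)
  then show ?case using step.IH uv by (auto simp: relcomp.simps)
qed

lemma bipartite_walk_parity:
  assumes "edges G \<subseteq> A \<times> B \<union> B \<times> A" and "A \<inter> B = {}" and "(x, y) \<in> edges G ^^ n"
    and "x \<in> A \<union> B"
  shows "(x \<in> A \<longleftrightarrow> y \<in> A) \<longleftrightarrow> even n"
  using assms(3)
proof (induction n arbitrary: y)
  case 0
  then show ?case by simp
next
  case (Suc n)
  then obtain z where z: "(x, z) \<in> edges G ^^ n" "(z, y) \<in> edges G" by auto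
  have "z \<in> A \<longleftrightarrow> y \<notin> A" using z(2) assms(1,2) by blast
  then show ?case using Suc.IH[OF z(1)] by auto
qed

text \<open>Prefixing the edges from \<open>x\<close> gives two walks of length \<open>Suc n\<close>
  from \<open>x\<close>, so by parity \<open>a\<close> and \<open>b\<close> lie in the same class,
  whereas \<open>u\<close> and \<open>v\<close> lie in different ones.\<close>

lemma walks_to_same_end:
  assumes "bipartite_graph G" and "(u, v) \<in> edges G" and "(x, w) \<in> edges G" "(x, w') \<in> edges G"
    and "a \<in> {u, v}" "b \<in> {u, v}" and "(w, a) \<in> edges G ^^ n" "(w', b) \<in> edges G ^^ n"
  shows "a = b"
proof -
  obtain A B where AB: "A \<inter> B = {}" "edges G \<subseteq> A \<times> B \<union> B \<times> A"
    using assms(1) unfolding bipartite_graph_def by blast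
  have "x \<in> A \<union> B" using AB assms(3) by blast
  then have "(x \<in> A \<longleftrightarrow> a \<in> A) \<longleftrightarrow> even (Suc n)" "(x \<in> A \<longleftrightarrow> b \<in> A) \<longleftrightarrow> even (Suc n)"
    using bipartite_walk_parity[OF AB(2,1)] relpow_Suc_I2 assms(3,4,7,8) by metis+
  moreover have "u \<in> A \<longleftrightarrow> v \<notin> A" using assms(2) AB by blast
  ultimately show ?thesis using assms(5,6) by auto
qed

lemma connected_nonisolated:
  assumes "ugraph G" and "connected_graph G" and "(u, v) \<in> edges G" and "z \<in> verts G"
  shows "\<exists>t. (z, t) \<in> edges G"
proof -
  have "(z, u) \<in> (edges G)\<^sup>*"
    using assms by (auto simp: connected_graph_def ugraph_def)
  then show ?thesis using assms(3) by (cases rule: converse_rtranclE) auto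
qed

section \<open>Domination of a farthest vertex\<close>

lemma exists_dominating_closer:
  assumes G: "ugraph G" and "finite_graph G" and conn: "connected_graph G" and "NU3_graph G"
    and uv: "(u, v) \<in> edges G" and loop_or_bip: "u = v \<or> bipartite_graph G"
    and ne: "\<not> verts G \<subseteq> {u, v}"
  obtains x x' where "dominates G x' x" "x \<notin> {u, v}"
    "dist_to_subgraph G (edge_subgraph u v) x' < dist_to_subgraph G (edge_subgraph u v) x"
proof -
  let ?D = "dist_to_subgraph G (edge_subgraph u v)"
  have V: "s \<in> verts G" "t \<in> verts G" "(t, s) \<in> edges G" if "(s, t) \<in> edges G" for s t
    using G that by (auto simp: ugraph_def dest: symD)
  obtain f where f: "graph_hom (graph_cube G) G f" and
    nu: "\<forall>x\<in>verts G. \<forall>y\<in>verts G. f (x, x, y) = x \<and> f (x, y, x) = x \<and> f (y, x, x) = x"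
    using \<open>NU3_graph G\<close> unfolding NU3_graph_def by blast
  have fin: "finite (verts G)" using assms(2) by (simp add: finite_graph_def)
  have absorb: "absorbing (verts G) f {y. (y, b) \<in> edges G ^^ n}" if "b \<in> verts G" for b n
    using absorbing_walks[OF G f nu _ that] connected_nonisolated[OF G conn uv] by blast
  let ?X = "verts G - {u, v}"
  have "finite (?D ` ?X)" "?D ` ?X \<noteq> {}" using fin ne by auto
  then have "Max (?D ` ?X) \<in> ?D ` ?X" by (rule Max_in)
  then obtain x where x: "x \<in> ?X" and "?D x = Max (?D ` ?X)" by force
  then have max: "?D w \<le> ?D x" if "w \<in> ?X" for w
    using that fin by simp
  \<comment> \<open>Connectedness makes the maximal distance finite.\<close>
  obtain k where "(x, u) \<in> edges G ^^ k"
    using conn x V[OF uv] unfolding connected_graph_def by (meson DiffD1 rtrancl_imp_relpow)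
  then have "?D x \<le> enat k" by (rule dist_to_edge_le) simp
  then obtain d where d: "?D x = enat d" by (cases "?D x") auto
  have "d \<noteq> 0"
  proof
    assume "d = 0"
    then have "?D x \<le> enat 0" using d by simp
    then show False by (rule dist_to_edge_le_imp_walk) (use x in auto)
  qed
  then obtain m where m: "d = Suc m" using not0_implies_Suc by blast
  \<comment> \<open>The maximum ranges over \<open>?X\<close> only, so neighbours in
    \<open>{u, v}\<close>, at distance 0, are treated separately. Lengthening then gives a walk of
    length exactly \<open>Suc m\<close>.\<close>
  have walk: "\<exists>a\<in>{u, v}. (w, a) \<in> edges G ^^ Suc m" if "(x, w) \<in> edges G" for w
  proof -
    have "?D w \<le> enat (Suc m)"
    proof (cases "w \<in> {u, v}")
      case True
      then have "?D w \<le> enat 0" by (intro dist_to_edge_le[of w w]) auto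
      then show ?thesis by (rule order_trans) simp
    next
      case False
      then show ?thesis using max[of w] V[OF that] d m by simp
    qed
    then show ?thesis
      using dist_to_edge_le_imp_walk walk_to_edge_extend[OF G uv] by metis
  qed
  \<comment> \<open>One neighbour \<open>w0\<close> fixes the end \<open>a\<close>; the others reach
    the same end by parity, or trivially if \<open>u = v\<close>.\<close>
  obtain a where a: "a \<in> {u, v}" "\<And>w. (x, w) \<in> edges G \<Longrightarrow> (w, a) \<in> edges G ^^ Suc m"
  proof -
    obtain w0 where w0: "(x, w0) \<in> edges G"
      using connected_nonisolated[OF G conn uv] x by blast
    obtain a where a: "a \<in> {u, v}" "(w0, a) \<in> edges G ^^ Suc m" using walk[OF w0] by blast
    have "(w, a) \<in> edges G ^^ Suc m" if w: "(x, w) \<in> edges G" for w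
    proof -
      obtain b where b: "b \<in> {u, v}" "(w, b) \<in> edges G ^^ Suc m" using walk[OF w] by blast
      have "a = b"
        using loop_or_bip walks_to_same_end[OF _ uv w0 w a(1) b(1) a(2) b(2)] a(1) b(1) by blast
      then show ?thesis using b(2) by simp
    qed
    then show thesis using that a(1) by blast
  qed
  let ?W = "{y. (y, a) \<in> edges G ^^ m}"
  let ?N = "\<lambda>w. {y. (y, w) \<in> edges G}"
  let ?F = "?N ` nbhd G x"
  have aV: "a \<in> verts G" using a(1) V[OF uv] by blast
  have "nbhd G x \<subseteq> verts G" using V by (auto simp: nbhd_def)
  then have finF: "finite ?F" using fin finite_subset by blast
  \<comment> \<open>\<open>?N w\<close> consists of the vertices with a walk of length 1 to
    \<open>w\<close>.\<close>
  have absN: "\<forall>B\<in>?F. absorbing (verts G) f B"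
    using absorb[where n = 1] V by (auto simp: nbhd_def)
  have meet: "?W \<inter> ?N w \<noteq> {}" if "w \<in> nbhd G x" for w
  proof -
    have "(w, a) \<in> edges G ^^ Suc m" using a(2) that by (simp add: nbhd_def)
    \<comment> \<open>The second vertex \<open>y\<close> of the walk lies in \<open>?W\<close> and,
      by symmetry of the edges, in \<open>?N w\<close>.\<close>
    then obtain y where "(w, y) \<in> edges G" "(y, a) \<in> edges G ^^ m" by (rule relpow_Suc_E2)
    then show ?thesis using V by blast
  qed
  have "\<exists>w. w \<in> nbhd G x"
    using connected_nonisolated[OF G conn uv] x by (auto simp: nbhd_def)
  then have "?W \<noteq> {}" using meet by blast
  moreover have "\<forall>B\<in>?F. ?W \<inter> B \<noteq> {}" using meet by blast
  \<comment> \<open>\<open>x\<close> itself is a common point.\<close>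
  moreover have "\<forall>B\<in>?F. \<forall>C\<in>?F. B \<inter> C \<noteq> {}"
    by (auto simp: nbhd_def)
  ultimately have "?W \<inter> \<Inter>?F \<noteq> {}"
    by (intro absorbing_Helly[OF finF absorb[OF aV] absN])
  then obtain x' where x': "(x', a) \<in> edges G ^^ m" "\<And>w. w \<in> nbhd G x \<Longrightarrow> (x', w) \<in> edges G"
    by blast
  have "?D x' \<le> enat m" using dist_to_edge_le[OF x'(1) a(1)] .
  also have "enat m < ?D x" using d m by simp
  finally have less: "?D x' < ?D x" .
  have "x' \<in> verts G" using x'(2) \<open>\<exists>w. w \<in> nbhd G x\<close> V by blast
  moreover have "x' \<noteq> x" using less by blast
  ultimately have "dominates G x' x" using x x'(2) by (auto simp: dominates_def nbhd_def)
  then show thesis using that x less by blast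
qed

section \<open>Retracts inherit the hypotheses and the distances\<close>

lemma graph_retraction_dismantle_map:
  assumes "ugraph G" and "dominates G x' x"
  shows "graph_retraction G (del_vertex G x) (dismantle_map x x')"
proof -
  have s: "(q, p) \<in> edges G" "p \<in> verts G" "q \<in> verts G" if "(p, q) \<in> edges G" for p q
    using assms(1) that by (auto simp: ugraph_def dest: symD)
  have d: "x \<in> verts G" "x' \<in> verts G" "x' \<noteq> x" "\<And>w. (x, w) \<in> edges G \<Longrightarrow> (x', w) \<in> edges G"
    using assms(2) by (auto simp: dominates_def nbhd_def)
  have "is_subgraph (del_vertex G x) G"
    using s by (auto simp: is_subgraph_def ugraph_def del_vertex_def intro!: symI)
  moreover have "(dismantle_map x x' p, dismantle_map x x' q) \<in> edges (del_vertex G x)"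
    if "(p, q) \<in> edges G" for p q
  proof -
    \<comment> \<open>Domination for the second end of an edge; a loop at \<open>x\<close> uses it
      together with \<open>d(4)\<close> to become a loop at \<open>x'\<close>.\<close>
    have "(w, x') \<in> edges G" if "(w, x) \<in> edges G" for w
      using d(4) s(1) that by blast
    then show ?thesis
      using that d(3,4)
      by (cases "p = x"; cases "q = x") (simp_all add: dismantle_map_def del_vertex_def)
  qed
  moreover have "dismantle_map x x' \<in> verts G \<rightarrow> verts (del_vertex G x)"
    and "\<forall>p\<in>verts (del_vertex G x). dismantle_map x x' p = p"
    using d by (auto simp: dismantle_map_def del_vertex_def)
  ultimately show ?thesis
    by (auto simp: graph_retraction_def graph_hom_def)
qed

lemma graph_hom_relpow:
  assumes "graph_hom G K r" and "(p, q) \<in> edges G ^^ n"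
  shows "(r p, r q) \<in> edges K ^^ n"
  using assms(2)
proof (induction n arbitrary: q)
  case 0
  then show ?case by simp
next
  case (Suc n)
  then obtain z where z: "(p, z) \<in> edges G ^^ n" "(z, q) \<in> edges G" by auto
  have "(r z, r q) \<in> edges K" using assms(1) z(2) by (auto simp: graph_hom_def)
  then show ?case using Suc.IH[OF z(1)] by auto
qed

text \<open>The retraction sends a walk in \<open>G\<close> to a walk of the same length in
  \<open>K\<close> and fixes its ends.\<close>

lemma graph_retraction_relpow_iff:
  assumes "graph_retraction G K r" and "p \<in> verts K" and "q \<in> verts K"
  shows "(p, q) \<in> edges G ^^ n \<longleftrightarrow> (p, q) \<in> edges K ^^ n"
proof
  assume "(p, q) \<in> edges G ^^ n"
  then have "(r p, r q) \<in> edges K ^^ n"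
    using graph_hom_relpow assms(1) unfolding graph_retraction_def by metis
  then show "(p, q) \<in> edges K ^^ n" using assms by (simp add: graph_retraction_def)
next
  have "edges K \<subseteq> edges G" using assms(1) by (simp add: graph_retraction_def is_subgraph_def)
  then have "edges K ^^ n \<subseteq> edges G ^^ n" by (induction n) auto
  then show "(p, q) \<in> edges K ^^ n \<Longrightarrow> (p, q) \<in> edges G ^^ n" by blast
qed

lemma graph_retraction_dist_to_subgraph:
  assumes "graph_retraction G K r" and "p \<in> verts K" and "verts R \<subseteq> verts K"
  shows "dist_to_subgraph K R p = dist_to_subgraph G R p"
  unfolding dist_to_subgraph_def graph_dist_def
  using graph_retraction_relpow_iff[OF assms(1,2)] assms(3)
  by (intro INF_cong refl) auto

lemma graph_retraction_connected:
  assumes "graph_retraction G K r" and "connected_graph G"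
  shows "connected_graph K"
proof -
  have "verts K \<subseteq> verts G" using assms(1) by (simp add: graph_retraction_def is_subgraph_def)
  then show ?thesis
    using assms graph_retraction_relpow_iff[OF assms(1)]
    unfolding connected_graph_def by (meson rtrancl_power subsetD)
qed

text \<open>Following \<open>f\<close> by the retraction preserves the identities, since
  \<open>r\<close> fixes the vertices of \<open>K\<close>.\<close>

lemma graph_retraction_NU3:
  assumes r: "graph_retraction G K r" and "NU3_graph G"
  shows "NU3_graph K"
proof -
  obtain f where f: "graph_hom (graph_cube G) G f" and
    nu: "\<forall>x\<in>verts G. \<forall>y\<in>verts G. f (x, x, y) = x \<and> f (x, y, x) = x \<and> f (y, x, x) = x"
    using assms(2) unfolding NU3_graph_def by blast
  have sub: "verts K \<subseteq> verts G" "edges K \<subseteq> edges G" and hom: "graph_hom G K r"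
    and fixed: "\<forall>x\<in>verts K. r x = x"
    using r by (auto simp: graph_retraction_def is_subgraph_def)
  have "verts (graph_cube K) \<subseteq> verts (graph_cube G)" "edges (graph_cube K) \<subseteq> edges (graph_cube G)"
    using sub by (auto simp: graph_cube_def)
  then have "graph_hom (graph_cube K) K (r \<circ> f)"
    using f hom unfolding graph_hom_def by fastforce
  moreover have "(r \<circ> f) (x, x, y) = x \<and> (r \<circ> f) (x, y, x) = x \<and> (r \<circ> f) (y, x, x) = x"
    if "x \<in> verts K" "y \<in> verts K" for x y
    using that sub(1) nu fixed by (metis comp_apply subsetD)
  ultimately show ?thesis unfolding NU3_graph_def by blast
qed

lemma graph_retraction_trans:
  assumes "graph_retraction G K r" and "graph_retraction K R s"
  shows "graph_retraction G R (s \<circ> r)"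
proof -
  have "graph_hom G R (s \<circ> r)"
    using assms unfolding graph_retraction_def graph_hom_def by fastforce
  then show ?thesis
    using assms by (auto simp: graph_retraction_def is_subgraph_def subset_iff)
qed

lemma bipartite_del_vertex:
  assumes "bipartite_graph G"
  shows "bipartite_graph (del_vertex G x)"
proof -
  obtain A B where "A \<union> B = verts G" "A \<inter> B = {}" "edges G \<subseteq> A \<times> B \<union> B \<times> A"
    using assms unfolding bipartite_graph_def by blast
  then show ?thesis
    unfolding bipartite_graph_def
    by (intro exI[of _ "A - {x}"] exI[of _ "B - {x}"]) (auto simp: del_vertex_def)
qed

section \<open>Induction on the number of vertices\<close>

lemma dismantling_seq_verts:
  assumes "dismantling_seq K ds" and "(p, p') \<in> set ds"
  shows "p \<in> verts K \<and> p' \<in> verts K"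
  using assms
  by (induction K ds rule: dismantling_seq.induct) (auto simp: dominates_def del_vertex_def)

text \<open>The disjunction \<open>u = v \<or> bipartite_graph G\<close> treats both claims in one
  induction: for \<open>u = v\<close> the target is a looped vertex.\<close>

lemma exists_efficient_dismantling:
  assumes "ugraph G" and "finite_graph G" and "connected_graph G" and "NU3_graph G"
    and "(u, v) \<in> edges G" and "u = v \<or> bipartite_graph G"
  shows "\<exists>ds. efficient_dismantling G (edge_subgraph u v) ds"
  using assms
proof (induction "card (verts G)" arbitrary: G rule: less_induct)
  case less
  let ?e = "edge_subgraph u v"
  note G = less.prems(1) and uv = less.prems(5)
  have fin: "finite (verts G)" using less.prems(2) by (simp add: finite_graph_def)
  have vu: "(v, u) \<in> edges G" and uvV: "u \<in> verts G" "v \<in> verts G"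
    using G uv by (auto simp: ugraph_def dest: symD)
  show ?case
  proof (cases "verts G \<subseteq> {u, v}")
    case True
    have "edges G \<subseteq> {(u, v), (v, u)}"
    proof -
      \<comment> \<open>For \<open>u \<noteq> v\<close>, a loop at an end would be an edge of
        \<open>G\<close> outside the edge subgraph; bipartiteness excludes it.\<close>
      have "u = v \<or> (u, u) \<notin> edges G \<and> (v, v) \<notin> edges G"
        using less.prems(6) unfolding bipartite_graph_def by blast
      then show ?thesis using G True by (auto simp: ugraph_def)
    qed
    then have "graph_retraction G ?e id"
      using True uv vu uvV
      by (auto simp: graph_retraction_def is_subgraph_def graph_hom_def edge_subgraph_def
          ugraph_def sym_def)
    then have "efficient_dismantling G ?e []"
      by (simp add: efficient_dismantling_def dismantling_def)
    then show ?thesis ..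
  next
    case False
    obtain x x' where dom: "dominates G x' x" and x: "x \<notin> {u, v}"
      and closer: "dist_to_subgraph G ?e x' < dist_to_subgraph G ?e x"
      using exists_dominating_closer[OF less.prems False] .
    let ?K = "del_vertex G x"
    have ret: "graph_retraction G ?K (dismantle_map x x')"
      by (rule graph_retraction_dismantle_map[OF G dom])
    have "x \<in> verts G" using dom by (simp add: dominates_def)
    then have "card (verts ?K) < card (verts G)"
      using card_Diff1_less[OF fin] by (simp add: del_vertex_def)
    moreover have "ugraph ?K" using ret by (simp add: graph_retraction_def is_subgraph_def)
    moreover have "finite_graph ?K" using fin by (simp add: finite_graph_def del_vertex_def)
    moreover have "(u, v) \<in> edges ?K" using uv x by (auto simp: del_vertex_def)
    moreover have "u = v \<or> bipartite_graph ?K"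
      using less.prems(6) bipartite_del_vertex[of G x] by argo
    ultimately have "\<exists>ds. efficient_dismantling ?K ?e ds"
      by (intro less.hyps graph_retraction_connected[OF ret less.prems(3)]
          graph_retraction_NU3[OF ret less.prems(4)])
    then obtain ds where ds: "efficient_dismantling ?K ?e ds" ..
    then have seq: "dismantling_seq ?K ds" and "graph_retraction ?K ?e (dismantling_comp ds)"
      by (simp_all add: efficient_dismantling_def dismantling_def)
    then have "dismantling G ?e ((x, x') # ds)"
      using dom graph_retraction_trans[OF ret] by (simp add: dismantling_def)
    moreover have "dist_to_subgraph G ?e p' < dist_to_subgraph G ?e p"
      if "(p, p') \<in> set ds" for p p'
    proof -
      \<comment> \<open>Later steps move vertices within \<open>?K\<close>, where distances to the
        edge agree with those in \<open>G\<close>; so the inequality known in \<open>?K\<close>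
        carries over.\<close>
      have "verts ?e \<subseteq> verts ?K" using uvV x by (auto simp: edge_subgraph_def del_vertex_def)
      then show ?thesis
        using ds that dismantling_seq_verts[OF seq that]
          graph_retraction_dist_to_subgraph[OF ret, of _ ?e]
        unfolding efficient_dismantling_def by fastforce
    qed
    ultimately have "efficient_dismantling G ?e ((x, x') # ds)"
      using closer by (auto simp: efficient_dismantling_def)
    then show ?thesis ..
  qed
qed

theorem lemma4p5:
  fixes H :: "'a ugraph"
  assumes "ugraph H" and "finite_graph H" and "connected_graph H" and "NU3_graph H"
  shows "(bipartite_graph H \<longrightarrow>
            (\<forall>(u, v)\<in>edges H. \<exists>ds. efficient_dismantling H (edge_subgraph u v) ds)) \<and>
         (\<forall>v. (v, v) \<in> edges H \<longrightarrow>
            (\<exists>ds. efficient_dismantling H (edge_subgraph v v) ds))"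
  by (auto intro: exists_efficient_dismantling[OF assms])

end
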